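(* Let $f:\mathbb{R}^n\to(-\infty,+\infty]$ be proper, closed and strongly convex with parameter $\mu_f>0$, let $g:\mathbb{R}^m\to(-\infty,+\infty]$ be proper, closed and convex ($\mu_g=0$), and let $A\in\mathbb{R}^{m\times n}$, $A\neq0$. Let $\{(x_{t+1},y_{t+1})\}$ be produced by EDPD (defined in the context) with $$\tau_t=(t+1)\tau,\qquad 0<\tau\le\frac{\mu_f}{2\|A\|^2},\qquad \eta_t=\frac{1}{\tau_t\|A\|^2},\qquad \alpha_{t+1}=\frac{t+2}{t+3}.$$ For $k\ge1$ define $$\tilde x_{k+1}=\frac{\sum_{t=1}^k(t+2)x_{t+1}}{\sum_{t=1}^k(t+2)},\qquad \tilde y_{k+1}=\frac{\sum_{t=1}^k(t+2)y_{t+1}}{\sum_{t=1}^k(t+2)},\qquad \tilde E_{k+1}=L(\tilde x_{k+1},y)-L(x,\tilde y_{k+1}).$$ Then for all $k\ge1$, $x\in X$ and $y\in Y$, $$\tilde E_{k+1}\le\frac{1}{k(k+5)}\left(6\tau\|A\|^2\|x-x_1\|^2+\frac{3}{2\tau}\|y-y_1\|^2\right).$$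
   Context: Saddle point problem: $\min_x\max_y L(x,y)$ with $L(x,y)=f(x)+\langle Ax,y\rangle-g(y)$. Norms are Euclidean, and $\|A\|$ is the operator norm. Put $X=\operatorname{dom} f$ and $Y=\operatorname{dom} g$ (the sets where $f$, $g$ are finite). A function $h$ is strongly convex with parameter $\mu\ge0$ if $h-\frac{\mu}{2}\|\cdot\|^2$ is convex. EDPD (exact method): given $x_1\in X$, $y_1\in Y$, parameters $\alpha_t\in\mathbb{R}$, $\tau_t>0$, $\eta_t>0$, set $\hat y_1=y_1$ (convention $y_0=y_1$), and for $t=1,2,\dots$ compute - $x_{t+1}=\arg\min_x\left\{f(x)+\langle Ax,\hat y_t\rangle+\frac{1}{2\eta_t}\|x-x_t\|^2\right\}$, - $y_{t+1}=\arg\min_y\left\{\frac{1}{2\tau_t}\|y-(y_t+\tau_tAx_{t+1})\|^2+g(y)\right\}$, - $\hat y_{t+1}=y_{t+1}+\alpha_{t+1}(y_{t+1}-y_t)$. *)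

theory Defs
  imports "HOL-Analysis.Analysis"
begin

definition proper :: "('a \<Rightarrow> ereal) \<Rightarrow> bool" where
  "proper h \<longleftrightarrow> (\<forall>x. h x \<noteq> -\<infinity>) \<and> (\<exists>x. h x \<noteq> \<infinity>)"

definition dom_fun :: "('a \<Rightarrow> ereal) \<Rightarrow> 'a set" where
  "dom_fun h = {x. \<bar>h x\<bar> \<noteq> \<infinity>}"

text \<open>The library's \<^verbatim>\<open>epigraph\<close> and \<^verbatim>\<open>convex_on\<close> only cover real-valued functions.\<close>

definition epi :: "('a \<Rightarrow> ereal) \<Rightarrow> ('a \<times> real) set" where
  "epi h = {(x, r). h x \<le> ereal r}"

definition closed_fun :: "('a::real_inner \<Rightarrow> ereal) \<Rightarrow> bool" where
  "closed_fun h \<longleftrightarrow> closed (epi h)"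

definition convex_fun :: "('a::real_inner \<Rightarrow> ereal) \<Rightarrow> bool" where
  "convex_fun h \<longleftrightarrow> convex (epi h)"

definition strongly_convex :: "real \<Rightarrow> ('a::real_inner \<Rightarrow> ereal) \<Rightarrow> bool" where
  "strongly_convex \<mu> h \<longleftrightarrow> convex_fun (\<lambda>x. h x - ereal (\<mu> / 2 * (norm x)\<^sup>2))"

text \<open>The saddle function \<open>L\<close>. Its value is a genuine (finite) real number whenever
  \<open>x\<close> and \<open>y\<close> lie in the domains of \<open>f\<close> and \<open>g\<close>.\<close>

definition saddle_fun ::
  "(real^'n \<Rightarrow> ereal) \<Rightarrow> (real^'m \<Rightarrow> ereal) \<Rightarrow> real^'n^'m \<Rightarrow> real^'n \<Rightarrow> real^'m \<Rightarrow> ereal" where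
  "saddle_fun f g A x y = f x + ereal ((A *v x) \<bullet> y) - g y"

text \<open>The sequences \<open>x\<close>, \<open>y\<close>, \<open>yh\<close> (\<open>yh\<close> stands for the extrapolated \<open>y\<close>) and the
  parameters are used at indices \<open>t \<ge> 1\<close> only; values at index \<open>0\<close> and \<open>\<alpha> 1\<close> play no role.
  The convention \<open>y 0 = y 1\<close> is rendered by \<open>yh 1 = y 1\<close>.\<close>

definition EDPD ::
  "(real^'n \<Rightarrow> ereal) \<Rightarrow> (real^'m \<Rightarrow> ereal) \<Rightarrow> real^'n^'m \<Rightarrow>
   (nat \<Rightarrow> real) \<Rightarrow> (nat \<Rightarrow> real) \<Rightarrow> (nat \<Rightarrow> real) \<Rightarrow>
   (nat \<Rightarrow> real^'n) \<Rightarrow> (nat \<Rightarrow> real^'m) \<Rightarrow> (nat \<Rightarrow> real^'m) \<Rightarrow> bool" where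
  "EDPD f g A \<alpha> \<tau> \<eta> x y yh \<longleftrightarrow>
     x 1 \<in> dom_fun f \<and> y 1 \<in> dom_fun g \<and> yh 1 = y 1 \<and>
     (\<forall>t\<ge>1. \<tau> t > 0 \<and> \<eta> t > 0 \<and>
       is_arg_min
         (\<lambda>u. f u + ereal ((A *v u) \<bullet> yh t) + ereal (1 / (2 * \<eta> t) * (norm (u - x t))\<^sup>2))
         (\<lambda>u. True) (x (t + 1)) \<and>
       is_arg_min
         (\<lambda>v. ereal (1 / (2 * \<tau> t) * (norm (v - (y t + \<tau> t *\<^sub>R (A *v x (t + 1)))))\<^sup>2) + g v)
         (\<lambda>v. True) (y (t + 1)) \<and>
       yh (t + 1) = y (t + 1) + \<alpha> (t + 1) *\<^sub>R (y (t + 1) - y t))"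

text \<open>\<open>weighted_avg z k\<close> is the average with index \<open>k + 1\<close>, formed from \<open>z 2, \<dots>, z (k + 1)\<close>.\<close>

definition weighted_avg :: "(nat \<Rightarrow> 'a::real_vector) \<Rightarrow> nat \<Rightarrow> 'a" where
  "weighted_avg z k =
     (\<Sum>t=1..k. (real t + 2) *\<^sub>R z (t + 1)) /\<^sub>R (\<Sum>t=1..k. (real t + 2))"

end

theory Submission
  imports Defs
begin

text \<open>
  Write \<open>a = \<parallel>A\<parallel>\<close>, \<open>w t = t + 2\<close> and \<open>d t = y (t + 1) - y t\<close>, with \<open>d 0 = 0\<close>. Each of the two
  minimisation steps of EDPD minimises a strongly convex function, so its objective grows at least
  quadratically away from the minimiser. Adding the two growth inequalities at a point \<open>(u, v)\<close>
  bounds \<open>L (x (t + 1)) v - L u (y (t + 1))\<close> by differences of squared distances, by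
  \<open>- \<parallel>x (t + 1) - x t\<parallel>\<^sup>2\<close> and \<open>- \<parallel>y (t + 1) - y t\<parallel>\<^sup>2\<close> terms, and by the coupling term
  \<open>(A (x (t + 1) - u)) \<bullet> (d t - \<alpha> t d (t - 1))\<close>.

  The weights are chosen such that \<open>w t * \<alpha> t = w (t - 1)\<close> for \<open>t \<ge> 2\<close>. After multiplication by \<open>w t\<close> the
  coupling term therefore telescopes up to \<open>w (t - 1) (A (x (t + 1) - x t)) \<bullet> d (t - 1)\<close>, which
  Young's inequality absorbs into the negative terms in \<open>x (t + 1) - x t\<close> and \<open>d (t - 1)\<close>, because
  \<open>w (t - 1) \<le> w t\<close> and \<open>\<eta> t * \<tau> (t - 1) * a\<^sup>2 \<le> 1\<close>. The squared
  distances in \<open>x\<close> telescope too: \<open>w (t + 1) / \<eta> (t + 1)\<close> exceeds \<open>w t / \<eta> t\<close> by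
  \<open>2 (t + 2) \<tau> a\<^sup>2\<close>, and strong convexity contributes \<open>w t * \<mu>f \<ge> 2 (t + 2) \<tau> a\<^sup>2\<close>. In \<open>y\<close> the
  coefficients \<open>w t / \<tau> t\<close> decrease of their own accord.

  All this is expressed by one potential, which bounds the weighted gap by its decrease
  (\<open>potential_decrease\<close>) and is nonnegative (\<open>potential_nonneg\<close>). The sum of the weighted gaps is
  thus at most the initial potential; Jensen's inequality for the averages, and
  \<open>w 1 + \<dots> + w k = k (k + 5) / 2\<close>, give the rate.
\<close>

section \<open>Extended-valued convex functions on their domain\<close>

lemma ereal_real_dom_fun: "u \<in> dom_fun h \<Longrightarrow> h u = ereal (real_of_ereal (h u))"
  by (simp add: dom_fun_def ereal_real')

text \<open>Finite values of \<open>h\<close> give points of the epigraph of the shifted function, whose convexity transfers to the domain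
  and to the real-valued restriction. The case \<open>\<mu> = 0\<close> is plain convexity.\<close>

lemma strongly_convex_convex_on:
  assumes "proper h" and "strongly_convex \<mu> h"
  shows "convex_on (dom_fun h) (\<lambda>u. real_of_ereal (h u) - \<mu> / 2 * (norm u)\<^sup>2)"
proof -
  let ?r = "\<lambda>u. real_of_ereal (h u) - \<mu> / 2 * (norm u)\<^sup>2"
  let ?E = "epi (\<lambda>u. h u - ereal (\<mu> / 2 * (norm u)\<^sup>2))"
  have E: "convex ?E"
    using assms(2) by (simp add: strongly_convex_def convex_fun_def)
  have in_E: "(u, ?r u) \<in> ?E" if "u \<in> dom_fun h" for u
    using ereal_real_dom_fun[OF that] by (cases "h u") (auto simp: epi_def)
  have E_D: "u \<in> dom_fun h \<and> ?r u \<le> s" if "(u, s) \<in> ?E" for u s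
  proof -
    have "h u \<noteq> -\<infinity>" using assms(1) by (simp add: proper_def)
    then show ?thesis
      using that by (cases "h u") (auto simp: epi_def dom_fun_def)
  qed
  have comb: "(1 - s) *\<^sub>R u + s *\<^sub>R v \<in> dom_fun h \<and>
      ?r ((1 - s) *\<^sub>R u + s *\<^sub>R v) \<le> (1 - s) * ?r u + s * ?r v"
    if "u \<in> dom_fun h" "v \<in> dom_fun h" "0 \<le> s" "s \<le> 1" for u v s
  proof -
    have "(1 - s) *\<^sub>R (u, ?r u) + s *\<^sub>R (v, ?r v) \<in> ?E"
      using convexD[OF E in_E[OF that(1)] in_E[OF that(2)], of "1 - s" s] that by simp
    then show ?thesis
      by (intro E_D) simp
  qed
  have "convex (dom_fun h)"
    unfolding convex_alt using comb by blast
  then show ?thesis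
    by (intro convex_onI) (use comb in auto)
qed

lemma strongly_convex_0: "strongly_convex 0 h \<longleftrightarrow> convex_fun h"
  by (simp add: strongly_convex_def flip: zero_ereal_def)

lemma convex_on_sq_norm:
  fixes S :: "'a::real_inner set"
  assumes "convex S" and "0 \<le> c"
  shows "convex_on S (\<lambda>u. c * (norm u)\<^sup>2)"
proof (rule convex_onI)
  fix t :: real and u v :: 'a
  assume t: "0 < t" "t < 1"
  have "(1 - t) * (norm u)\<^sup>2 + t * (norm v)\<^sup>2 - (norm ((1 - t) *\<^sub>R u + t *\<^sub>R v))\<^sup>2
      = t * (1 - t) * (norm (u - v))\<^sup>2"
    by (simp add: power2_norm_eq_inner inner_simps inner_commute algebra_simps)
  also have "\<dots> \<ge> 0" using t by simp
  finally have "(norm ((1 - t) *\<^sub>R u + t *\<^sub>R v))\<^sup>2 \<le> (1 - t) * (norm u)\<^sup>2 + t * (norm v)\<^sup>2"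
    by simp
  from mult_left_mono[OF this assms(2)]
  show "c * (norm ((1 - t) *\<^sub>R u + t *\<^sub>R v))\<^sup>2 \<le> (1 - t) * (c * (norm u)\<^sup>2) + t * (c * (norm v)\<^sup>2)"
    by (simp add: algebra_simps)
qed (rule assms(1))

lemma strongly_convex_convex_on_real:
  assumes "proper h" and "strongly_convex \<mu> h" and "0 \<le> \<mu>"
  shows "convex_on (dom_fun h) (\<lambda>u. real_of_ereal (h u))"
proof -
  have r: "convex_on (dom_fun h) (\<lambda>u. real_of_ereal (h u) - \<mu> / 2 * (norm u)\<^sup>2)"
    using assms(1,2) by (rule strongly_convex_convex_on)
  have "convex_on (dom_fun h) (\<lambda>u. \<mu> / 2 * (norm u)\<^sup>2)"
    using convex_on_imp_convex[OF r] assms(3) by (intro convex_on_sq_norm) auto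
  from convex_on_add[OF r this] show ?thesis by simp
qed

section \<open>Quadratic growth at the minimiser of a proximal step\<close>

text \<open>Comparing the minimiser \<open>p\<close> with points of the segment towards \<open>u\<close> gives the claim with
  \<open>(1 - s) * m\<close> for \<open>m\<close>, and \<open>s\<close> may tend to \<open>0\<close>.\<close>

lemma minimiser_quadratic_growth:
  fixes F :: "'a::real_inner \<Rightarrow> real"
  assumes conv: "convex_on S (\<lambda>u. F u - m / 2 * (norm u)\<^sup>2)"
    and p: "p \<in> S" and min: "\<And>u. u \<in> S \<Longrightarrow> F p \<le> F u" and u: "u \<in> S"
  shows "F p + m / 2 * (norm (u - p))\<^sup>2 \<le> F u"
proof -
  have ev: "F p + m / 2 * (1 - s) * (norm (u - p))\<^sup>2 \<le> F u" if s: "0 < s" "s < 1" for s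
  proof -
    let ?z = "(1 - s) *\<^sub>R p + s *\<^sub>R u"
    have "?z \<in> S"
      using convex_on_imp_convex[OF conv] p u s by (simp add: convex_alt)
    then have "F p \<le> F ?z" by (rule min)
    also have "F ?z \<le> (1 - s) * (F p - m / 2 * (norm p)\<^sup>2) + s * (F u - m / 2 * (norm u)\<^sup>2)
        + m / 2 * (norm ?z)\<^sup>2"
      using convex_onD[OF conv, of s p u] p u s by simp
    also have "\<dots> = (1 - s) * F p + s * F u - s * (m / 2 * (1 - s) * (norm (u - p))\<^sup>2)"
      by (simp add: power2_norm_eq_inner inner_simps inner_commute field_simps)
    finally have "s * (F p + m / 2 * (1 - s) * (norm (u - p))\<^sup>2) \<le> s * F u"
      by (simp add: algebra_simps)
    then show ?thesis using s by simp
  qed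
  have "((\<lambda>s. F p + m / 2 * (1 - s) * (norm (u - p))\<^sup>2)
      \<longlongrightarrow> F p + m / 2 * (1 - 0) * (norm (u - p))\<^sup>2) (at_right 0)"
    by (intro tendsto_intros)
  moreover have "\<forall>\<^sub>F s in at_right (0::real). F p + m / 2 * (1 - s) * (norm (u - p))\<^sup>2 \<le> F u"
    unfolding eventually_at_right_field using ev by (intro exI[of _ 1]) auto
  ultimately show ?thesis
    using tendsto_upperbound[of _ _ "at_right (0::real)"] by fastforce
qed

text \<open>The proximal term has exactly the curvature \<open>c\<close>, so the objective is strongly convex with
  parameter \<open>\<mu> + c\<close>. The minimiser has a finite value because \<open>h\<close> is proper.\<close>

lemma proximal_step:
  fixes h :: "'a::real_inner \<Rightarrow> ereal" and b z :: 'a and c :: real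
  defines "q \<equiv> \<lambda>u. b \<bullet> u + c / 2 * (norm (u - z))\<^sup>2"
  assumes h: "proper h" "strongly_convex \<mu> h"
    and min: "is_arg_min (\<lambda>u. h u + ereal (q u)) (\<lambda>u. True) p"
  shows "p \<in> dom_fun h"
    and "u \<in> dom_fun h \<Longrightarrow>
      real_of_ereal (h p) + q p + (\<mu> + c) / 2 * (norm (u - p))\<^sup>2 \<le> real_of_ereal (h u) + q u"
proof -
  have le: "h p + ereal (q p) \<le> h v + ereal (q v)" for v
    using min by (auto simp: is_arg_min_def not_less)
  obtain v where "h v \<noteq> \<infinity>" and "h p \<noteq> -\<infinity>"
    using h(1) by (auto simp: proper_def)
  then show p: "p \<in> dom_fun h"
    using le[of v] by (cases "h p"; cases "h v") (auto simp: dom_fun_def)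
  assume u: "u \<in> dom_fun h"
  have r: "convex_on (dom_fun h) (\<lambda>u. real_of_ereal (h u) - \<mu> / 2 * (norm u)\<^sup>2)"
    using h by (rule strongly_convex_convex_on)
  have "convex_on (dom_fun h) (\<lambda>u. q u - c / 2 * (norm u)\<^sup>2)"
    using convex_on_imp_convex[OF r]
    by (intro convex_onI)
      (auto simp: q_def power2_norm_eq_inner inner_simps inner_commute field_simps)
  from convex_on_add[OF r this]
  have conv: "convex_on (dom_fun h)
      (\<lambda>u. (real_of_ereal (h u) + q u) - (\<mu> + c) / 2 * (norm u)\<^sup>2)"
    by (simp add: algebra_simps add_divide_distrib)
  have "real_of_ereal (h p) + q p \<le> real_of_ereal (h v) + q v" if "v \<in> dom_fun h" for v
    using le[of v] ereal_real_dom_fun[OF p] ereal_real_dom_fun[OF that]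
    by (metis ereal_less_eq(3) plus_ereal.simps(1))
  from minimiser_quadratic_growth[OF conv p this u]
  show "real_of_ereal (h p) + q p + (\<mu> + c) / 2 * (norm (u - p))\<^sup>2 \<le> real_of_ereal (h u) + q u" .
qed

section \<open>The potential\<close>

text \<open>At iteration \<open>t = r + 1\<close>, the arguments \<open>p\<close> and \<open>q\<close> are the deviations of \<open>x t\<close> and \<open>y t\<close>
  from the comparison point, \<open>e\<close> is the image of \<open>p\<close> under the coupling operator and \<open>d\<close> is the
  preceding increment of \<open>y\<close>. The coefficients of the first two terms are \<open>w t / (2 \<eta> t)\<close> and
  \<open>w t / (2 \<tau> t)\<close>. The last two terms are the part of the telescoping coupling that is left over
  and the reserve from which the next iteration pays for the remainder of its coupling term.\<close>

definition potential ::
  "real \<Rightarrow> real \<Rightarrow> real \<Rightarrow> 'a::real_inner \<Rightarrow> 'b::real_inner \<Rightarrow> 'b \<Rightarrow> 'b \<Rightarrow> real" where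
  "potential \<tau> a r p q e d =
     (r + 3) * (r + 2) * \<tau> * a\<^sup>2 / 2 * (norm p)\<^sup>2 + (r + 3) / (2 * (r + 2) * \<tau>) * (norm q)\<^sup>2
     - (r + 2) * (e \<bullet> d) + (r + 2) / (2 * (r + 1) * \<tau>) * (norm d)\<^sup>2"

text \<open>Young's inequality, split such that the \<open>d\<close>-term matches that of the potential for
  \<open>s = (r + 1) * \<tau>\<close>.\<close>

lemma young_inner:
  fixes p :: "'a::real_inner" and e d :: "'b::real_inner"
  assumes "norm e \<le> a * norm p" and "0 < s"
  shows "\<bar>e \<bullet> d\<bar> \<le> s * a\<^sup>2 / 2 * (norm p)\<^sup>2 + 1 / (2 * s) * (norm d)\<^sup>2"
proof -
  have sq: "(norm e)\<^sup>2 \<le> a\<^sup>2 * (norm p)\<^sup>2"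
    using power_mono[OF assms(1), of 2] by (simp add: power_mult_distrib)
  have "0 \<le> (s * norm e - norm d)\<^sup>2" by simp
  then have "2 * s * (norm e * norm d) \<le> s\<^sup>2 * (norm e)\<^sup>2 + (norm d)\<^sup>2"
    by (simp add: power2_eq_square algebra_simps)
  then have "norm e * norm d \<le> s / 2 * (norm e)\<^sup>2 + 1 / (2 * s) * (norm d)\<^sup>2"
    using assms(2) by (simp add: field_simps power2_eq_square)
  moreover have "s / 2 * (norm e)\<^sup>2 \<le> s / 2 * (a\<^sup>2 * (norm p)\<^sup>2)"
    using sq assms(2) by (intro mult_left_mono) auto
  moreover have "\<bar>e \<bullet> d\<bar> \<le> norm e * norm d" by (rule Cauchy_Schwarz_ineq2)
  ultimately show ?thesis by (simp add: algebra_simps)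
qed

text \<open>The coupling term has arbitrary sign, but by Young's inequality it is dominated by the terms in
  \<open>p\<close> and \<open>d\<close>. Hence the potential left after the last iteration can be dropped.\<close>

lemma potential_nonneg:
  assumes "norm e \<le> a * norm p" and "0 < \<tau>" and "0 \<le> r"
  shows "0 \<le> potential \<tau> a r p q e d"
proof -
  have "e \<bullet> d \<le> (r + 1) * \<tau> * a\<^sup>2 / 2 * (norm p)\<^sup>2 + 1 / (2 * ((r + 1) * \<tau>)) * (norm d)\<^sup>2"
    using young_inner[OF assms(1), of "(r + 1) * \<tau>" d] assms(2,3) by simp
  from mult_left_mono[OF this, of "r + 2"] assms(3)
  have "(r + 2) * (e \<bullet> d) \<le> (r + 2) * ((r + 1) * (\<tau> * a\<^sup>2 / 2 * (norm p)\<^sup>2))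
      + (r + 2) / (2 * (r + 1) * \<tau>) * (norm d)\<^sup>2"
    by (simp add: algebra_simps)
  moreover have "(r + 2) * ((r + 1) * (\<tau> * a\<^sup>2 / 2 * (norm p)\<^sup>2))
      \<le> (r + 2) * ((r + 3) * (\<tau> * a\<^sup>2 / 2 * (norm p)\<^sup>2))"
    using assms(2,3) by (intro mult_left_mono mult_right_mono) auto
  moreover have "0 \<le> (r + 3) / (2 * (r + 2) * \<tau>) * (norm q)\<^sup>2"
    using assms(2,3) by simp
  moreover have "potential \<tau> a r p q e d = (r + 2) * ((r + 3) * (\<tau> * a\<^sup>2 / 2 * (norm p)\<^sup>2))
      + (r + 3) / (2 * (r + 2) * \<tau>) * (norm q)\<^sup>2 - (r + 2) * (e \<bullet> d)
      + (r + 2) / (2 * (r + 1) * \<tau>) * (norm d)\<^sup>2"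
    by (simp add: potential_def mult_ac)
  ultimately show ?thesis by linarith
qed

text \<open>The hypotheses on \<open>fx\<close> and \<open>gy\<close> are the growth inequalities of the two proximal steps;
  \<open>fx\<close>, \<open>fu\<close>, \<open>gy\<close>, \<open>gv\<close> stand for the values of \<open>f\<close> and \<open>g\<close> at the new iterates and at the
  comparison point.\<close>

lemma potential_decrease:
  fixes x x' u :: "'a::real_inner" and y y' v yh d :: "'b::real_inner" and T :: "'a \<Rightarrow> 'b"
    and \<tau> a r :: real
  defines "c \<equiv> \<lambda>r. (r + 2) * \<tau> * a\<^sup>2"
  assumes T: "linear T" "norm (T (x' - x)) \<le> a * norm (x' - x)"
    and \<tau>: "0 < \<tau>" "2 * \<tau> * a\<^sup>2 \<le> \<mu>" and r: "0 \<le> r"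
    and yh: "yh = y + ((r + 2) / (r + 3)) *\<^sub>R d"
    and fx: "fx + T x' \<bullet> yh + c r / 2 * (norm (x' - x))\<^sup>2 + (\<mu> + c r) / 2 * (norm (u - x'))\<^sup>2
        \<le> fu + T u \<bullet> yh + c r / 2 * (norm (u - x))\<^sup>2"
    and gy: "gy - T x' \<bullet> y' + 1 / (2 * ((r + 2) * \<tau>)) * ((norm (y' - y))\<^sup>2 + (norm (v - y'))\<^sup>2)
        \<le> gv - T x' \<bullet> v + 1 / (2 * ((r + 2) * \<tau>)) * (norm (v - y))\<^sup>2"
  shows "(r + 3) * ((fx + T x' \<bullet> v - gv) - (fu + T u \<bullet> y' - gy))
    \<le> potential \<tau> a r (x - u) (y - v) (T (x - u)) d
      - potential \<tau> a (r + 1) (x' - u) (y' - v) (T (x' - u)) (y' - y)"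
proof -
  define N where "N = (norm (x' - u))\<^sup>2"
  define M where "M = (norm (x' - x))\<^sup>2"
  define N0 where "N0 = (norm (x - u))\<^sup>2"
  define Q where "Q = (norm (y' - v))\<^sup>2"
  define Q0 where "Q0 = (norm (y - v))\<^sup>2"
  define B where "B = (norm (y' - y))\<^sup>2"
  define k where "k = 1 / (2 * ((r + 2) * \<tau>))"
  have pos: "0 \<le> N" "0 \<le> M" "0 \<le> Q" by (simp_all add: N_def M_def Q_def)
  have lin: "T (x' - u) = T x' - T u" "T (x - u) = T x - T u" "T (x' - x) = T x' - T x"
    using T(1) by (simp_all add: linear_diff)
  have "(fx + T x' \<bullet> v - gv) - (fu + T u \<bullet> y' - gy)
      \<le> c r / 2 * N0 - (\<mu> + c r) / 2 * N - c r / 2 * M + k * Q0 - k * Q - k * B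
        + (T x' - T u) \<bullet> (y' - yh)"
    using fx gy
    by (simp add: N_def M_def N0_def Q_def Q0_def B_def k_def norm_minus_commute
        inner_diff_left inner_diff_right algebra_simps)
  from mult_left_mono[OF this, of "r + 3"] r
  have "(r + 3) * ((fx + T x' \<bullet> v - gv) - (fu + T u \<bullet> y' - gy))
      \<le> (r + 3) * (c r / 2 * N0 - (\<mu> + c r) / 2 * N - c r / 2 * M + k * Q0 - k * Q - k * B)
        + (r + 3) * ((T x' - T u) \<bullet> (y' - yh))"
    by (simp add: algebra_simps)
  also have "(r + 3) * ((T x' - T u) \<bullet> (y' - yh))
      = (r + 3) * (T (x' - u) \<bullet> (y' - y)) - (r + 2) * (T (x - u) \<bullet> d) - (r + 2) * (T (x' - x) \<bullet> d)"
  proof -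
    have "(r + 3) *\<^sub>R (y' - yh) = (r + 3) *\<^sub>R (y' - y) - (r + 2) *\<^sub>R d"
      using r by (simp add: yh scaleR_diff_right scaleR_add_right diff_diff_eq)
    then have "(r + 3) * ((T x' - T u) \<bullet> (y' - yh))
        = (T x' - T u) \<bullet> ((r + 3) *\<^sub>R (y' - y) - (r + 2) *\<^sub>R d)"
      by (metis inner_scaleR_right)
    then show ?thesis
      by (simp add: lin inner_diff_left inner_diff_right algebra_simps)
  qed
  finally have 1: "(r + 3) * ((fx + T x' \<bullet> v - gv) - (fu + T u \<bullet> y' - gy))
      \<le> (r + 3) * (c r / 2 * N0 - (\<mu> + c r) / 2 * N - c r / 2 * M + k * Q0 - k * Q - k * B)
        + ((r + 3) * (T (x' - u) \<bullet> (y' - y)) - (r + 2) * (T (x - u) \<bullet> d)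
          - (r + 2) * (T (x' - x) \<bullet> d))" .
  have "- (T (x' - x) \<bullet> d) \<le> (r + 1) * \<tau> * a\<^sup>2 / 2 * M + 1 / (2 * ((r + 1) * \<tau>)) * (norm d)\<^sup>2"
    using young_inner[OF T(2), of "(r + 1) * \<tau>" d] \<tau> r by (simp add: M_def)
  from mult_left_mono[OF this, of "r + 2"] r
  have 2: "- ((r + 2) * (T (x' - x) \<bullet> d)) \<le> (r + 2) * ((r + 1) * (\<tau> * a\<^sup>2 / 2 * M))
      + (r + 2) / (2 * (r + 1) * \<tau>) * (norm d)\<^sup>2"
    by (simp add: algebra_simps)
  have 3: "(r + 2) * ((r + 1) * (\<tau> * a\<^sup>2 / 2 * M)) \<le> (r + 3) * (c r / 2 * M)"
  proof -
    have "(r + 2) * ((r + 1) * (\<tau> * a\<^sup>2 / 2 * M)) \<le> (r + 2) * ((r + 3) * (\<tau> * a\<^sup>2 / 2 * M))"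
      using \<tau>(1) r pos by (intro mult_left_mono mult_right_mono) auto
    then show ?thesis by (simp add: c_def algebra_simps)
  qed
  have 4: "(r + 4) * (c (r + 1) / 2 * N) \<le> (r + 3) * ((\<mu> + c r) / 2 * N)"
  proof -
    \<comment> \<open>\<open>(r + 4) c (r + 1) = (r + 3) (2 \<tau> a\<^sup>2 + c r)\<close>: this is where the bound on \<open>\<tau>\<close> enters.\<close>
    have "(r + 4) * (c (r + 1) / 2 * N) = (r + 3) * ((2 * \<tau> * a\<^sup>2 + c r) / 2 * N)"
      by (simp add: c_def field_simps)
    also have "\<dots> \<le> (r + 3) * ((\<mu> + c r) / 2 * N)"
      using \<tau>(2) r pos by (intro mult_left_mono mult_right_mono divide_right_mono add_right_mono) auto
    finally show ?thesis .
  qed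
  have 5: "(r + 4) / (2 * (r + 3) * \<tau>) * Q \<le> (r + 3) * (k * Q)"
  proof -
    have "(r + 4) * (r + 2) \<le> (r + 3) * (r + 3)" by (simp add: algebra_simps)
    then have "(r + 4) / (r + 3) \<le> (r + 3) / (r + 2)"
      using r by (simp add: divide_simps mult.commute)
    then have "(r + 4) / (r + 3) * (1 / (2 * \<tau>) * Q) \<le> (r + 3) / (r + 2) * (1 / (2 * \<tau>) * Q)"
      using \<tau>(1) pos by (intro mult_right_mono) auto
    then show ?thesis by (simp add: k_def mult_ac)
  qed
  have A: "potential \<tau> a r (x - u) (y - v) (T (x - u)) d
      = (r + 3) * (c r / 2 * N0) + (r + 3) * (k * Q0) - (r + 2) * (T (x - u) \<bullet> d)
        + (r + 2) / (2 * (r + 1) * \<tau>) * (norm d)\<^sup>2"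
    by (simp add: potential_def c_def k_def N0_def Q0_def mult_ac)
  have B: "potential \<tau> a (r + 1) (x' - u) (y' - v) (T (x' - u)) (y' - y)
      = (r + 4) * (c (r + 1) / 2 * N) + (r + 4) / (2 * (r + 3) * \<tau>) * Q
        - (r + 3) * (T (x' - u) \<bullet> (y' - y)) + (r + 3) * (k * B)"
    by (simp add: potential_def c_def k_def N_def Q_def B_def mult_ac add.commute)
  show ?thesis
    using 1 2 3 4 5 unfolding A B by (simp add: right_diff_distrib distrib_left)
qed

section \<open>Averages\<close>

lemma sum_weights: "(\<Sum>t=1..k. real t + 2) = real k * (real k + 5) / 2"
  by (induction k) (auto simp: field_simps)

lemma weighted_avg_eq:
  "weighted_avg z k = (\<Sum>t=1..k. ((real t + 2) / (\<Sum>t=1..k. real t + 2)) *\<^sub>R z (t + 1))"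
  by (simp add: weighted_avg_def scaleR_right.sum divide_inverse mult.commute)

lemma weighted_avg_Jensen:
  assumes conv: "convex_on S h" and z: "\<And>t. t \<ge> 1 \<Longrightarrow> z (t + 1) \<in> S" and "k \<ge> 1"
  shows "weighted_avg z k \<in> S"
    and "(\<Sum>t=1..k. real t + 2) * h (weighted_avg z k) \<le> (\<Sum>t=1..k. (real t + 2) * h (z (t + 1)))"
proof -
  define W where "W = (\<Sum>t=1..k. real t + 2)"
  have W: "W > 0" using \<open>k \<ge> 1\<close> by (simp add: W_def sum_weights del: One_nat_def)
  have one: "(\<Sum>t=1..k. (real t + 2) / W) = 1"
    using W by (simp add: W_def flip: sum_divide_distrib)
  show "weighted_avg z k \<in> S"
    unfolding weighted_avg_eq W_def[symmetric]
    using W z one by (intro convex_sum convex_on_imp_convex[OF conv]) auto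
  have "h (weighted_avg z k) \<le> (\<Sum>t=1..k. (real t + 2) / W * h (z (t + 1)))"
    unfolding weighted_avg_eq W_def[symmetric]
    using W z one \<open>k \<ge> 1\<close> by (intro convex_on_sum[OF _ _ conv]) auto
  also have "\<dots> = (\<Sum>t=1..k. (real t + 2) * h (z (t + 1))) / W"
    by (simp add: sum_divide_distrib)
  finally show "(\<Sum>t=1..k. real t + 2) * h (weighted_avg z k) \<le> (\<Sum>t=1..k. (real t + 2) * h (z (t + 1)))"
    unfolding W_def[symmetric] using W by (simp add: pos_le_divide_eq mult.commute)
qed

lemma weighted_avg_linear:
  assumes "linear l"
  shows "(\<Sum>t=1..k. real t + 2) * l (weighted_avg z k) = (\<Sum>t=1..k. (real t + 2) * l (z (t + 1)))"
proof (cases "k = 0")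
  case False
  define W where "W = (\<Sum>t=1..k. real t + 2)"
  have "W \<noteq> 0" using False by (simp add: W_def sum_weights del: One_nat_def)
  moreover have "l (weighted_avg z k) = inverse W * (\<Sum>t=1..k. (real t + 2) * l (z (t + 1)))"
    unfolding weighted_avg_def W_def[symmetric]
    by (simp add: linear_scale[OF assms] linear_sum[OF assms])
  ultimately show ?thesis
    unfolding W_def[symmetric] by simp
qed simp

section \<open>The convergence rate\<close>

theorem theorem4p1:
  fixes f :: "real^'n \<Rightarrow> ereal" and g :: "real^'m \<Rightarrow> ereal" and A :: "real^'n^'m"
    and \<mu>f \<tau> :: real and \<alpha> \<tau>s \<eta>s :: "nat \<Rightarrow> real"
    and xs :: "nat \<Rightarrow> real^'n" and ys yhs :: "nat \<Rightarrow> real^'m"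
    and x :: "real^'n" and y :: "real^'m" and k :: nat
  assumes "proper f" and "closed_fun f" and "\<mu>f > 0" and "strongly_convex \<mu>f f"
    and "proper g" and "closed_fun g" and "convex_fun g"
    and "A \<noteq> 0"
    and "0 < \<tau>" and "\<tau> \<le> \<mu>f / (2 * (onorm ((*v) A))\<^sup>2)"
    and "\<And>t. t \<ge> 1 \<Longrightarrow> \<tau>s t = (real t + 1) * \<tau>"
    and "\<And>t. t \<ge> 1 \<Longrightarrow> \<eta>s t = 1 / (\<tau>s t * (onorm ((*v) A))\<^sup>2)"
    and "\<And>t. t \<ge> 1 \<Longrightarrow> \<alpha> (t + 1) = (real t + 2) / (real t + 3)"
    and "EDPD f g A \<alpha> \<tau>s \<eta>s xs ys yhs"
    and "k \<ge> 1" and "x \<in> dom_fun f" and "y \<in> dom_fun g"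
  shows "saddle_fun f g A (weighted_avg xs k) y - saddle_fun f g A x (weighted_avg ys k)
    \<le> ereal (1 / (real k * (real k + 5)) *
        (6 * \<tau> * (onorm ((*v) A))\<^sup>2 * (norm (x - xs 1))\<^sup>2
          + 3 / (2 * \<tau>) * (norm (y - ys 1))\<^sup>2))"
proof -
  define a where "a = onorm ((*v) A)"
  define fr where "fr = (\<lambda>u. real_of_ereal (f u))"
  define gr where "gr = (\<lambda>v. real_of_ereal (g v))"
  \<comment> \<open>With \<open>D 0 = 0\<close> the extrapolation formula also covers \<open>yhs 1 = ys 1\<close>.\<close>
  define D where "D = (\<lambda>j. if j = 0 then 0 else ys (j + 1) - ys j)"
  define \<Phi> where "\<Phi> = (\<lambda>j. potential \<tau> a (real j) (xs (j + 1) - x) (ys (j + 1) - y)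
    (A *v (xs (j + 1) - x)) (D j))"
  define gap where "gap = (\<lambda>t. (fr (xs (t + 1)) + (A *v xs (t + 1)) \<bullet> y - gr y)
    - (fr x + (A *v x) \<bullet> ys (t + 1) - gr (ys (t + 1))))"

  have norm_A: "norm (A *v u) \<le> a * norm u" for u
    unfolding a_def by (rule onorm) simp
  have a: "a > 0"
  proof -
    have "(*v) A \<noteq> (\<lambda>_. 0)"
      using \<open>A \<noteq> 0\<close> matrix_eq[of A 0] by (metis matrix_vector_mult_0)
    then show ?thesis
      unfolding a_def by (subst onorm_pos_lt) auto
  qed
  have \<mu>: "2 * \<tau> * a\<^sup>2 \<le> \<mu>f"
    using assms(10) a by (simp add: a_def[symmetric] field_simps)

  have conv_g: "strongly_convex 0 g" using assms(7) by (simp add: strongly_convex_0)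

  have x_step: "xs (t + 1) \<in> dom_fun f"
      "fr (xs (t + 1)) + (A *v xs (t + 1)) \<bullet> yhs t + (real t + 1) * \<tau> * a\<^sup>2 / 2 * (norm (xs (t + 1) - xs t))\<^sup>2
          + (\<mu>f + (real t + 1) * \<tau> * a\<^sup>2) / 2 * (norm (x - xs (t + 1)))\<^sup>2
        \<le> fr x + (A *v x) \<bullet> yhs t + (real t + 1) * \<tau> * a\<^sup>2 / 2 * (norm (x - xs t))\<^sup>2"
    if t: "t \<ge> 1" for t
  proof -
    have \<eta>: "1 / (2 * \<eta>s t) = (real t + 1) * \<tau> * a\<^sup>2 / 2"
      using assms(11,12) t by (simp add: a_def)
    have dual: "(A *v u) \<bullet> yhs t = (yhs t v* A) \<bullet> u" for u
      by (metis dot_lmul_matrix inner_commute)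
    have "is_arg_min (\<lambda>u. f u + ereal ((A *v u) \<bullet> yhs t)
        + ereal (1 / (2 * \<eta>s t) * (norm (u - xs t))\<^sup>2)) (\<lambda>u. True) (xs (t + 1))"
      using assms(14) t unfolding EDPD_def by blast
    then have "is_arg_min (\<lambda>u. f u + ereal ((yhs t v* A) \<bullet> u
        + (real t + 1) * \<tau> * a\<^sup>2 / 2 * (norm (u - xs t))\<^sup>2)) (\<lambda>u. True) (xs (t + 1))"
      unfolding \<eta> dual by (simp add: add.assoc)
    from proximal_step[OF assms(1,4) this] \<open>x \<in> dom_fun f\<close>
    show "xs (t + 1) \<in> dom_fun f"
      "fr (xs (t + 1)) + (A *v xs (t + 1)) \<bullet> yhs t + (real t + 1) * \<tau> * a\<^sup>2 / 2 * (norm (xs (t + 1) - xs t))\<^sup>2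
          + (\<mu>f + (real t + 1) * \<tau> * a\<^sup>2) / 2 * (norm (x - xs (t + 1)))\<^sup>2
        \<le> fr x + (A *v x) \<bullet> yhs t + (real t + 1) * \<tau> * a\<^sup>2 / 2 * (norm (x - xs t))\<^sup>2"
      by (simp_all add: fr_def dual add.assoc)
  qed

  have y_step: "ys (t + 1) \<in> dom_fun g"
      "gr (ys (t + 1)) - (A *v xs (t + 1)) \<bullet> ys (t + 1)
          + 1 / (2 * ((real t + 1) * \<tau>)) * ((norm (ys (t + 1) - ys t))\<^sup>2 + (norm (y - ys (t + 1)))\<^sup>2)
        \<le> gr y - (A *v xs (t + 1)) \<bullet> y + 1 / (2 * ((real t + 1) * \<tau>)) * (norm (y - ys t))\<^sup>2"
    if t: "t \<ge> 1" for t
  proof -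
    define s where "s = (real t + 1) * \<tau>"
    define b where "b = A *v xs (t + 1)"
    have s: "\<tau>s t = s" "s > 0" using assms(9,11) t by (auto simp: s_def)
    have "is_arg_min (\<lambda>v. ereal (1 / (2 * \<tau>s t) * (norm (v - (ys t + \<tau>s t *\<^sub>R (A *v xs (t + 1)))))\<^sup>2)
        + g v) (\<lambda>v. True) (ys (t + 1))"
      using assms(14) t unfolding EDPD_def by blast
    then have min: "is_arg_min (\<lambda>v. g v + ereal (0 \<bullet> v + (1 / s) / 2 * (norm (v - (ys t + s *\<^sub>R b)))\<^sup>2))
        (\<lambda>v. True) (ys (t + 1))"
      unfolding s b_def[symmetric] by (simp add: add.commute mult.commute)
    note prox = proximal_step[OF assms(5) conv_g min]
    show "ys (t + 1) \<in> dom_fun g" by (rule prox(1))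
    \<comment> \<open>The proximal term contains the coupling \<open>- b \<bullet> v\<close>; the part that is constant in \<open>v\<close> cancels.\<close>
    have expand: "(1 / s) / 2 * (norm (v - (ys t + s *\<^sub>R b)))\<^sup>2
        = 1 / (2 * s) * (norm (v - ys t))\<^sup>2 - b \<bullet> v + (b \<bullet> ys t + s / 2 * (norm b)\<^sup>2)" for v
      using s(2) unfolding power2_norm_eq_inner
      by (simp add: inner_simps inner_commute field_simps)
    show "gr (ys (t + 1)) - (A *v xs (t + 1)) \<bullet> ys (t + 1)
          + 1 / (2 * ((real t + 1) * \<tau>)) * ((norm (ys (t + 1) - ys t))\<^sup>2 + (norm (y - ys (t + 1)))\<^sup>2)
        \<le> gr y - (A *v xs (t + 1)) \<bullet> y + 1 / (2 * ((real t + 1) * \<tau>)) * (norm (y - ys t))\<^sup>2"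
      using prox(2)[OF \<open>y \<in> dom_fun g\<close>] unfolding expand s_def[symmetric] b_def[symmetric] gr_def
      by (simp add: distrib_left)
  qed

  have decrease: "(real (Suc j) + 2) * gap (Suc j) \<le> \<Phi> j - \<Phi> (Suc j)" for j
  proof -
    have yh: "yhs (Suc j) = ys (Suc j) + ((real j + 2) / (real j + 3)) *\<^sub>R D j"
    proof (cases "j = 0")
      case True
      then show ?thesis using assms(14) by (simp add: EDPD_def D_def)
    next
      case False
      then have "yhs (j + 1) = ys (j + 1) + \<alpha> (j + 1) *\<^sub>R (ys (j + 1) - ys j)"
        using assms(14) unfolding EDPD_def by (metis One_nat_def Suc_leI neq0_conv)
      then show ?thesis using False assms(13)[of j] by (simp add: D_def)
    qed
    have "(real j + 3) * gap (Suc j) \<le> potential \<tau> a (real j) (xs (Suc j) - x) (ys (Suc j) - y)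
        (A *v (xs (Suc j) - x)) (D j)
      - potential \<tau> a (real j + 1) (xs (Suc j + 1) - x) (ys (Suc j + 1) - y)
        (A *v (xs (Suc j + 1) - x)) (ys (Suc j + 1) - ys (Suc j))"
      unfolding gap_def
      by (rule potential_decrease[OF matrix_vector_mul_linear norm_A assms(9) \<mu> _ yh])
        (use x_step(2)[of "Suc j"] y_step(2)[of "Suc j"] in \<open>simp_all add: add.commute\<close>)
    then show ?thesis by (simp add: \<Phi>_def D_def add.commute)
  qed
  have telescope: "(\<Sum>t=1..n. (real t + 2) * gap t) \<le> \<Phi> 0 - \<Phi> n" for n
  proof (induction n)
    case (Suc n)
    then show ?case using decrease[of n] by simp
  qed simp
  have "0 \<le> \<Phi> k"
    unfolding \<Phi>_def using norm_A assms(9) by (intro potential_nonneg) auto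
  then have sum_gap: "(\<Sum>t=1..k. (real t + 2) * gap t) \<le> \<Phi> 0"
    using telescope[of k] by linarith
  have \<Phi>0: "\<Phi> 0 = 3 * \<tau> * a\<^sup>2 * (norm (x - xs 1))\<^sup>2 + 3 / (4 * \<tau>) * (norm (y - ys 1))\<^sup>2"
    by (simp add: \<Phi>_def potential_def D_def norm_minus_commute)

  let ?X = "weighted_avg xs k" and ?Y = "weighted_avg ys k"
  let ?W = "\<Sum>t=1..k. real t + 2"
  have conv_f: "convex_on (dom_fun f) fr"
    unfolding fr_def using assms(1,3,4) by (intro strongly_convex_convex_on_real) auto
  have conv_gr: "convex_on (dom_fun g) gr"
    unfolding gr_def using assms(5) conv_g by (intro strongly_convex_convex_on_real) auto
  have X: "?X \<in> dom_fun f" "?W * fr ?X \<le> (\<Sum>t=1..k. (real t + 2) * fr (xs (t + 1)))"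
    using weighted_avg_Jensen[OF conv_f] x_step(1) \<open>k \<ge> 1\<close> by blast+
  have Y: "?Y \<in> dom_fun g" "?W * gr ?Y \<le> (\<Sum>t=1..k. (real t + 2) * gr (ys (t + 1)))"
    using weighted_avg_Jensen[OF conv_gr] y_step(1) \<open>k \<ge> 1\<close> by blast+
  have linX: "?W * ((A *v ?X) \<bullet> y) = (\<Sum>t=1..k. (real t + 2) * ((A *v xs (t + 1)) \<bullet> y))"
    by (rule weighted_avg_linear[of "\<lambda>u. (A *v u) \<bullet> y"])
      (auto intro!: linearI simp: matrix_vector_right_distrib inner_add_left
        matrix_vector_mult_scaleR)
  have linY: "?W * ((A *v x) \<bullet> ?Y) = (\<Sum>t=1..k. (real t + 2) * ((A *v x) \<bullet> ys (t + 1)))"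
    by (rule weighted_avg_linear[of "\<lambda>v. (A *v x) \<bullet> v"]) (auto intro!: linearI simp: inner_add_right)
  have "(\<Sum>t=1..k. (real t + 2) * gap t)
      = (\<Sum>t=1..k. (real t + 2) * fr (xs (t + 1))) + (\<Sum>t=1..k. (real t + 2) * ((A *v xs (t + 1)) \<bullet> y))
        - ?W * gr y - (?W * fr x + (\<Sum>t=1..k. (real t + 2) * ((A *v x) \<bullet> ys (t + 1)))
        - (\<Sum>t=1..k. (real t + 2) * gr (ys (t + 1))))"
    unfolding gap_def sum_distrib_right right_diff_distrib distrib_left
    by (simp only: sum.distrib sum_subtractf)
  then have "?W * ((fr ?X + (A *v ?X) \<bullet> y - gr y) - (fr x + (A *v x) \<bullet> ?Y - gr ?Y))
      \<le> (\<Sum>t=1..k. (real t + 2) * gap t)"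
    using X(2) Y(2) linX linY unfolding right_diff_distrib distrib_left[of ?W] by linarith
  also have "\<dots> \<le> \<Phi> 0" by (rule sum_gap)
  finally have bound: "real k * (real k + 5) / 2 *
      ((fr ?X + (A *v ?X) \<bullet> y - gr y) - (fr x + (A *v x) \<bullet> ?Y - gr ?Y)) \<le> \<Phi> 0"
    by (simp only: sum_weights)
  have "(fr ?X + (A *v ?X) \<bullet> y - gr y) - (fr x + (A *v x) \<bullet> ?Y - gr ?Y)
      \<le> 1 / (real k * (real k + 5)) * (2 * \<Phi> 0)"
  proof -
    have "real k * (real k + 5) > 0" using \<open>k \<ge> 1\<close> by simp
    then show ?thesis using bound by (simp add: pos_le_divide_eq mult.commute)
  qed
  also have "2 * \<Phi> 0 = 6 * \<tau> * a\<^sup>2 * (norm (x - xs 1))\<^sup>2 + 3 / (2 * \<tau>) * (norm (y - ys 1))\<^sup>2"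
    by (simp add: \<Phi>0 field_simps)
  finally have real_bound: "(fr ?X + (A *v ?X) \<bullet> y - gr y) - (fr x + (A *v x) \<bullet> ?Y - gr ?Y)
      \<le> 1 / (real k * (real k + 5)) *
        (6 * \<tau> * a\<^sup>2 * (norm (x - xs 1))\<^sup>2 + 3 / (2 * \<tau>) * (norm (y - ys 1))\<^sup>2)" .
  have saddle: "saddle_fun f g A u v = ereal (fr u + (A *v u) \<bullet> v - gr v)"
    if "u \<in> dom_fun f" "v \<in> dom_fun g" for u v
    unfolding saddle_fun_def fr_def gr_def
    using ereal_real_dom_fun[OF that(1)] ereal_real_dom_fun[OF that(2)]
    by (metis ereal_minus(1) plus_ereal.simps(1))
  show ?thesis
    using real_bound
    unfolding saddle[OF X(1) \<open>y \<in> dom_fun g\<close>] saddle[OF \<open>x \<in> dom_fun f\<close> Y(1)] a_def[symmetric]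
    by simp
qed

end
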